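(* Let $n,m\ge0$ be integers and let $a,b,c,d$ be real numbers such that all the Wilson polynomials appearing below are well defined (no denominator vanishes in their defining formulas, for degrees $k$ with $m\le k\le m+n-1$ on the left and $n\le k\le n+m-1$ on the right). With $$W^{a,b,c,d}_{n,m,x}=\frac{\det\left(w^{a,b,c,d}_{m+j-1}\bigl(-(x+i-1)^2\bigr)\right)_{i,j=1}^n}{\prod_{l=1}^{n-1}(2x+l)_l},$$ we have $$W_{n,m,\,x+a-\frac n2-\frac m2}^{a-\frac n2-\frac m2,\;b-\frac n2-\frac m2,\;c-\frac n2-\frac m2,\;d-\frac n2-\frac m2}=W_{m,n,\,-x-a+1}^{-d+1,\,-b+1,\,-a+1,\,-c+1}.$$
   Context: The (normalized) Wilson polynomials are $$w_k^{a,b,c,d}(x)=\sum_{j=0}^k\frac{(a+b+j)_{k-j}(a+c+j)_{k-j}(a+d+j)_{k-j}}{(k-j)!\,(k+a+b+c+d-1+j)_{k-j}}g_j(x),\qquad g_j(x)=\frac{(-1)^j}{j!}\prod_{i=0}^{j-1}\bigl(x+(a+i)^2\bigr),$$ where $(u)_l=u(u+1)\cdots(u+l-1)$, $(u)_0=1$; they are well defined when $(k+a+b+c+d-1+j)_{k-j}\ne0$ for $0\le j\le k$. A $0\times0$ determinant and an empty product equal $1$. The identity is an identity of rational functions of $x$. *)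

theory Defs
  imports
    Jordan_Normal_Form.Determinant
    "HOL-Computational_Algebra.Polynomial"
    "HOL-Computational_Algebra.Fraction_Field"
begin

definition wilson_basis :: "real \<Rightarrow> nat \<Rightarrow> real poly" where
  "wilson_basis a j = smult ((-1) ^ j / fact j) (\<Prod>i<j. [:(a + real i)\<^sup>2, 1:])"

definition wilson_well_defined :: "real \<Rightarrow> real \<Rightarrow> real \<Rightarrow> real \<Rightarrow> nat \<Rightarrow> bool" where
  "wilson_well_defined a b c d k \<longleftrightarrow>
    (\<forall>j\<le>k. pochhammer (real k + a + b + c + d - 1 + real j) (k - j) \<noteq> 0)"

definition wilson_poly :: "real \<Rightarrow> real \<Rightarrow> real \<Rightarrow> real \<Rightarrow> nat \<Rightarrow> real poly" where
  "wilson_poly a b c d k =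
    (\<Sum>j\<le>k. smult
       (pochhammer (a + b + real j) (k - j) * pochhammer (a + c + real j) (k - j)
          * pochhammer (a + d + real j) (k - j)
        / (fact (k - j) * pochhammer (real k + a + b + c + d - 1 + real j) (k - j)))
       (wilson_basis a j))"

(* X is the polynomial substituted for the shifted argument of W.  The rows and columns of mat
   are numbered from 0, hence the entry w_(m+j)(-(X+i)^2). *)
definition wilson_det ::
    "real \<Rightarrow> real \<Rightarrow> real \<Rightarrow> real \<Rightarrow> nat \<Rightarrow> nat \<Rightarrow> real poly \<Rightarrow> real poly" where
  "wilson_det a b c d n m X =
    det (mat n n (\<lambda>(i, j). wilson_poly a b c d (m + j) \<circ>\<^sub>p (- ((X + of_nat i)\<^sup>2))))"

definition wilson_denom :: "nat \<Rightarrow> real poly \<Rightarrow> real poly" where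
  "wilson_denom n X = (\<Prod>l\<in>{1..<n}. pochhammer (2 * X + of_nat l) l)"

(* An element of the field of rational functions R(x); for nonconstant X the denominator does
   not vanish, by wilson_denom_nonzero below. *)
definition wilson_W ::
    "real \<Rightarrow> real \<Rightarrow> real \<Rightarrow> real \<Rightarrow> nat \<Rightarrow> nat \<Rightarrow> real poly \<Rightarrow> real poly fract" where
  "wilson_W a b c d n m X = Fract (wilson_det a b c d n m X) (wilson_denom n X)"

lemma wilson_denom_nonzero:
  assumes "degree X > 0"
  shows "wilson_denom n X \<noteq> 0"
proof -
  have "2 * X + of_nat k \<noteq> 0" for k :: nat
  proof
    assume "2 * X + of_nat k = 0"
    then have "coeff (2 * X + of_nat k) (degree X) = 0"
      by simp
    moreover have "coeff (2 * X + of_nat k) (degree X) = 2 * lead_coeff X"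
      using assms by (simp add: of_nat_poly numeral_poly coeff_pCons split: nat.splits)
    ultimately show False
      using assms by auto
  qed
  then have "2 * X + of_nat l + of_nat i \<noteq> 0" for l i :: nat
    by (metis add.assoc of_nat_add)
  then show ?thesis
    by (simp add: wilson_denom_def pochhammer_prod)
qed

end

(* Expand w_k in the basis g_l^(X), whose parameter is the evaluation point X itself instead of a.
   This basis is triangular at the nodes -X^2, -(X+1)^2, ..., with diagonal entries (2X+i)_i, so the
   determinant divided by its denominator is the minor with rows m, ..., m+n-1 and columns
   0, ..., n-1 of a unitriangular connection matrix C = M(a) B(a,X).  Its inverse is B(X,d) M(d)^-1,
   because M(a) B(a,d) = M(d) by the Saalschuetz summation (the symmetry of the Wilson polynomials).
   Reflected in the antidiagonal of the square of size N = n + m, and up to checkerboard signs, the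
   inverse is the connection matrix for the parameters u |-> 1 - u - N/2.  Hence the two sides of the
   identity are complementary minors of a matrix and its inverse. *)

theory Submission
  imports Defs
begin

section \<open>Complementary minors of inverse triangular matrices\<close>

(* The equality of complementary minors of a unitriangular matrix p and its inverse q, assuming
   only the rows k >= m of p and the columns j < m of q to be known: outside this range the
   coefficients of the Wilson polynomials need not be well defined. *)
lemma complementary_minors:
  fixes p q :: "nat \<Rightarrow> nat \<Rightarrow> 'a::idom"
  assumes p_diag: "\<And>k. m \<le> k \<Longrightarrow> k < m + n \<Longrightarrow> p k k = 1"
    and p_upper: "\<And>k l. m \<le> k \<Longrightarrow> k < l \<Longrightarrow> l < m + n \<Longrightarrow> p k l = 0"
    and q_diag: "\<And>j. j < m \<Longrightarrow> q j j = 1"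
    and q_upper: "\<And>l j. l < j \<Longrightarrow> j < m \<Longrightarrow> q l j = 0"
    and orth: "\<And>k j. m \<le> k \<Longrightarrow> k < m + n \<Longrightarrow> j < m \<Longrightarrow> (\<Sum>l<m + n. p k l * q l j) = 0"
  shows "det (mat n n (\<lambda>(i, j). p (m + i) j))
       = (-1) ^ (m * n) * det (mat m m (\<lambda>(i, j). q (n + i) j))"
proof -
  define P where "P = mat n n (\<lambda>(i, j). p (m + i) j)"
  define Q where "Q = mat m m (\<lambda>(i, j). q (n + i) j)"
  define E where "E = mat n n (\<lambda>(i, j). p (m + i) (m + j))"
  \<comment> \<open>Rows \<open>m\<close>, ..., \<open>m + n - 1\<close> of \<open>p\<close> are
    completed by unit rows to \<open>G\<close>, columns \<open>0\<close>, ..., \<open>m - 1\<close>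
    of \<open>q\<close> by unit columns to \<open>V\<close>. Then \<open>G * V\<close> is block
    lower triangular with diagonal blocks \<open>E\<close> and \<open>Q\<close>, and
    \<open>det G\<close> is \<open>det P\<close>.\<close>
  define G where "G = four_block_mat P (mat n m (\<lambda>(i, j). p (m + i) (n + j))) (0\<^sub>m m n) (1\<^sub>m m)"
  define V where "V = mat (n + m) (n + m)
    (\<lambda>(i, j). if j < n then (if i = m + j then 1 else 0) else q i (j - n))"
  have G: "G \<in> carrier_mat (n + m) (n + m)" and V: "V \<in> carrier_mat (n + m) (n + m)"
    by (simp_all add: G_def V_def P_def)
  have G_entry: "G $$ (i, j) = (if i < n then p (m + i) j else if i = j then 1 else 0)"
    if "i < n + m" "j < n + m" for i j
    using that by (auto simp: G_def P_def)
  have "det G = det P * det (1\<^sub>m m)"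
    unfolding G_def by (rule det_four_block_mat_lower_left_zero) (auto simp: P_def)
  then have det_G: "det G = det P"
    by simp
  have det_E: "det E = 1"
  proof -
    have "det E = prod_list (diag_mat E)"
      by (rule det_lower_triangular[of n]) (auto simp: E_def p_upper)
    then show ?thesis
      by (simp add: prod_list_diag_prod) (simp add: E_def p_diag)
  qed
  \<comment> \<open>Moving the last \<open>m\<close> columns of \<open>V\<close> to the front leaves
    a lower unitriangular matrix, at the cost of the sign of this block exchange.\<close>
  have "det V = (-1) ^ (m * n) * det (mat (m + n) (m + n)
      (\<lambda>(i, j). V $$ (i, if j < m then j + n else j - m)))" (is "_ = _ * det ?L")
    by (rule det_swap_cols) (simp add: V_def add.commute)
  also have "det ?L = prod_list (diag_mat ?L)"
    by (rule det_lower_triangular[of "m + n"]) (auto simp: V_def q_upper)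
  also have "\<dots> = 1"
    by (auto simp: prod_list_diag_prod V_def q_diag intro!: prod.neutral)
  finally have det_V: "det V = (-1) ^ (m * n)"
    by simp
  have "G * V = four_block_mat E (0\<^sub>m n m) (mat m n (\<lambda>(i, j). if n + i = m + j then 1 else 0)) Q"
    (is "_ = ?R")
  proof (rule eq_matI)
    fix i j
    assume "i < dim_row ?R" "j < dim_col ?R"
    then have ij: "i < n + m" "j < n + m"
      by (auto simp: E_def Q_def)
    have "(G * V) $$ (i, j) = (\<Sum>l<n + m. G $$ (i, l) * V $$ (l, j))"
      using ij G V by (auto simp: scalar_prod_def lessThan_atLeast0)
    also have "\<dots> = (\<Sum>l<n + m. (if i < n then p (m + i) l else if i = l then 1 else 0) * V $$ (l, j))"
      using ij by (intro sum.cong) (auto simp: G_entry)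
    also have "\<dots> = ?R $$ (i, j)"
    proof (cases "i < n")
      case True
      show ?thesis
      proof (cases "j < n")
        case jn: True
        have "(\<Sum>l<n + m. (if i < n then p (m + i) l else if i = l then 1 else 0) * V $$ (l, j))
            = (\<Sum>l<n + m. if l = m + j then p (m + i) l else 0)"
          using True jn by (intro sum.cong) (auto simp: V_def)
        then show ?thesis
          using True jn by (simp add: E_def Q_def)
      next
        case False
        have "(\<Sum>l<n + m. (if i < n then p (m + i) l else if i = l then 1 else 0) * V $$ (l, j))
            = (\<Sum>l<m + n. p (m + i) l * q l (j - n))"
          using True False ij by (intro sum.cong) (auto simp: V_def)
        also have "\<dots> = 0"
          using True False ij by (intro orth) auto
        finally show ?thesis
          using True False ij by (simp add: E_def Q_def)
      qed
    next
      case False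
      have "(\<Sum>l<n + m. (if i < n then p (m + i) l else if i = l then 1 else 0) * V $$ (l, j))
          = (\<Sum>l<n + m. if l = i then V $$ (l, j) else 0)"
        using False by (intro sum.cong) auto
      then show ?thesis
        using False ij by (auto simp: V_def E_def Q_def)
    qed
    finally show "(G * V) $$ (i, j) = ?R $$ (i, j)" .
  qed (use G V in \<open>auto simp: E_def Q_def\<close>)
  then have "det G * det V = det ?R"
    using det_mult[OF G V] by simp
  also have "\<dots> = det E * det Q"
    by (rule det_four_block_mat_upper_right_zero) (auto simp: E_def Q_def)
  finally have "det P * (-1) ^ (m * n) = det Q"
    by (simp add: det_G det_V det_E mult.commute)
  then have "det P * ((-1) ^ (m * n) * (-1) ^ (m * n)) = (-1) ^ (m * n) * det Q"
    by (metis mult.assoc mult.commute)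
  then show ?thesis
    by (simp add: P_def Q_def flip: power_mult_distrib)
qed

section \<open>Terminating hypergeometric sums\<close>

text \<open>As \<open>(x+s)_i (x-s)_i\<close> is the product of \<open>(x+k)^2 - s^2\<close> over
  \<open>k < i\<close>, this is the change from the parameter \<open>a\<close> to \<open>x\<close>
  in the basis of the Wilson polynomials, up to normalization. The induction on \<open>j\<close>
  multiplies the expansion by the next factor and avoids division.\<close>

lemma pochhammer_pair_convolution:
  fixes a s x :: "'a::comm_ring_1"
  shows "(\<Sum>i\<le>j. of_nat (j choose i) *
            (pochhammer (a + x + of_nat i) (j - i) * pochhammer (a - x) (j - i)) *
            (pochhammer (x + s) i * pochhammer (x - s) i))
       = pochhammer (a + s) j * pochhammer (a - s) j"
proof (induction j)
  case 0
  then show ?case by simp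
next
  case (Suc j)
  define c where "c j i = pochhammer (a + x + of_nat i) (j - i) * pochhammer (a - x) (j - i)" for j i
  define g where "g i = pochhammer (x + s) i * pochhammer (x - s) i" for i
  define b where "b i = (of_nat (j choose i) :: 'a)" for i
  \<comment> \<open>The new factor is
    \<open>(a+j)^2 - s^2 = ((a+j)^2 - (x+i)^2) + ((x+i)^2 - s^2)\<close>: the first part keeps
    \<open>g i\<close> and contributes \<open>u i\<close>, the second raises \<open>g i\<close> to
    \<open>g (Suc i)\<close>.\<close>
  define u where "u i = b i * c j i * ((a + of_nat j - x - of_nat i) * (a + of_nat j + x + of_nat i))" for i
  have g_Suc: "g (Suc i) = g i * ((x + s + of_nat i) * (x - s + of_nat i))" for i
    by (simp add: g_def pochhammer_Suc algebra_simps)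
  have u_Suc: "u (Suc i) + b i * c j i = of_nat (Suc j choose Suc i) * c (Suc j) (Suc i)" if "i \<le> j" for i
  proof (cases "i = j")
    case True
    then show ?thesis by (simp add: u_def b_def c_def binomial_eq_0)
  next
    case False
    then have "i < j"
      using that by simp
    then obtain r where j: "j = i + 1 + r"
      using less_imp_Suc_add by force
    have absorb: "b (Suc i) * of_nat (Suc i) = b i * of_nat (Suc r)"
    proof -
      have "(j choose Suc i) * Suc i = (j choose i) * Suc r"
        using binomial_absorption[of i j] binomial_absorb_comp[of j i]
        by (simp add: j mult.commute)
      then show ?thesis
        unfolding b_def by (metis of_nat_mult)
    qed
    define p where "p = pochhammer (a + x + of_nat (Suc i)) r"
    define w where "w = pochhammer (a - x) r"
    have c1: "c j (Suc i) = p * w"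
      by (simp add: c_def p_def w_def j)
    have "pochhammer (a + x + of_nat i) (Suc r) = (a + x + of_nat i) * p"
      unfolding p_def by (subst pochhammer_rec) (simp add: add_ac)
    then have c2: "c j i = (a + x + of_nat i) * p * (w * (a - x + of_nat r))"
      by (simp add: c_def w_def j pochhammer_Suc[of "a - x"] algebra_simps)
    have c3: "c (Suc j) (Suc i) = p * (a + x + of_nat (Suc i) + of_nat r) * (w * (a - x + of_nat r))"
      by (simp add: c_def p_def w_def j pochhammer_Suc)
    \<comment> \<open>Once the common factors are taken out, what remains is exactly the difference
      of the two sides of \<open>absorb\<close>.\<close>
    have "u (Suc i) + b i * c j i - of_nat (Suc j choose Suc i) * c (Suc j) (Suc i)
        = p * w * (a - x + of_nat r) * (b (Suc i) * of_nat (Suc i) - b i * of_nat (Suc r))"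
      unfolding u_def c1 c2 c3 binomial_Suc_Suc of_nat_add b_def[symmetric]
      by (simp add: j algebra_simps)
    then show ?thesis
      using absorb by simp
  qed
  have IH: "pochhammer (a + s) j * pochhammer (a - s) j = (\<Sum>i\<le>j. b i * c j i * g i)"
    using Suc.IH by (simp only: b_def c_def g_def)
  have "pochhammer (a + s) (Suc j) * pochhammer (a - s) (Suc j)
      = (\<Sum>i\<le>j. b i * c j i * g i) * ((a + s + of_nat j) * (a - s + of_nat j))"
    unfolding IH[symmetric] pochhammer_Suc by (simp only: mult_ac)
  also have "\<dots> = (\<Sum>i\<le>j. u i * g i + b i * c j i * g (Suc i))"
    unfolding sum_distrib_right by (intro sum.cong) (auto simp: u_def g_Suc algebra_simps)
  also have "\<dots> = (\<Sum>i\<le>Suc j. u i * g i) + (\<Sum>i\<le>j. b i * c j i * g (Suc i))"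
    by (simp add: sum.distrib u_def b_def binomial_eq_0)
  also have "\<dots> = u 0 * g 0 + (\<Sum>i\<le>j. (u (Suc i) + b i * c j i) * g (Suc i))"
    by (simp only: sum.atMost_Suc_shift sum.distrib distrib_right add.assoc)
  also have "\<dots> = (\<Sum>i\<le>Suc j. of_nat (Suc j choose i) * c (Suc j) i * g i)"
    unfolding sum.atMost_Suc_shift
    by (intro arg_cong2[of _ _ _ _ "(+)"] sum.cong)
      (auto simp: u_Suc, simp add: u_def b_def c_def pochhammer_Suc algebra_simps)
  finally show ?case
    by (simp add: c_def g_def mult.assoc)
qed

text \<open>Negate every factor and reverse their order. Since the relation between \<open>x\<close>
  and \<open>y\<close> is a hypothesis, each application leaves only a linear identity between
  parameters to check.\<close>

lemma pochhammer_reflect: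
  fixes x y :: "'a::comm_ring_1"
  assumes "x + y + of_nat n = 1"
  shows "pochhammer x n = (-1) ^ n * pochhammer y n"
proof -
  have "- y - of_nat n + 1 = x"
    using assms by (simp add: algebra_simps)
  then show ?thesis
    using pochhammer_minus[of "- y" n] by simp
qed

text \<open>A finite difference of order \<open>k\<close> annihilates polynomials of degree
  \<open>r < k\<close>.\<close>

lemma alternating_sum_pochhammer:
  fixes s :: "'a::comm_ring_1"
  assumes "r < k"
  shows "(\<Sum>i\<le>k. (-1) ^ i * of_nat (k choose i) * pochhammer (s + of_nat i) r) = 0"
  using assms
proof (induction k arbitrary: s r)
  case 0
  then show ?case by simp
next
  case (Suc k)
  define f where "f i = pochhammer (s + of_nat i) r" for i
  have "(\<Sum>i\<le>Suc k. (-1) ^ i * of_nat (Suc k choose i) * f i)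
      = f 0 + ((\<Sum>i\<le>k. (-1) ^ Suc i * of_nat (k choose i) * f (Suc i))
        + (\<Sum>i\<le>k. (-1) ^ Suc i * of_nat (k choose Suc i) * f (Suc i)))"
    unfolding sum.atMost_Suc_shift by (simp add: algebra_simps sum_subtractf sum_negf del: sum.atMost_Suc)
  also have "f 0 + (\<Sum>i\<le>k. (-1) ^ Suc i * of_nat (k choose Suc i) * f (Suc i))
      = (\<Sum>i\<le>Suc k. (-1) ^ i * of_nat (k choose i) * f i)"
    unfolding sum.atMost_Suc_shift by simp
  then have "f 0 + ((\<Sum>i\<le>k. (-1) ^ Suc i * of_nat (k choose i) * f (Suc i))
        + (\<Sum>i\<le>k. (-1) ^ Suc i * of_nat (k choose Suc i) * f (Suc i)))
      = (\<Sum>i\<le>k. (-1) ^ i * of_nat (k choose i) * (f i - f (Suc i)))"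
    by (simp add: algebra_simps sum_subtractf sum_negf binomial_eq_0)
  also have "\<dots> = 0"
  proof (cases r)
    case 0
    then show ?thesis by (simp add: f_def)
  next
    case (Suc t)
    \<comment> \<open>One difference step turns a rising factorial of length \<open>r\<close> into a
      multiple of one of length \<open>r - 1\<close>, to which the induction hypothesis
      applies.\<close>
    have "f i - f (Suc i) = - of_nat r * pochhammer (s + 1 + of_nat i) t" for i
      unfolding f_def Suc
      by (subst pochhammer_rec, subst pochhammer_Suc) (simp add: algebra_simps)
    then have "(\<Sum>i\<le>k. (-1) ^ i * of_nat (k choose i) * (f i - f (Suc i)))
        = - of_nat r * (\<Sum>i\<le>k. (-1) ^ i * of_nat (k choose i) * pochhammer (s + 1 + of_nat i) t)"
      by (simp add: sum_distrib_left mult_ac)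
    also have "\<dots> = 0"
      using Suc.IH[of t "s + 1"] Suc.prems Suc by simp
    finally show ?thesis .
  qed
  finally show ?case
    by (simp add: f_def)
qed

text \<open>The Saalschuetz sum of the balanced series
  \<open>3F2(-k, w, k+u+v-w-1; u, v; 1)\<close>, multiplied by \<open>(u)_k (v)_k\<close> to clear
  denominators. It is \<open>pochhammer_pair_convolution\<close> with \<open>a = u - x\<close> and
  \<open>s = w - x\<close>, after reflecting two of the factors.\<close>

lemma saalschuetz:
  fixes u v w :: real
  shows "(\<Sum>j\<le>k. (-1) ^ j * real (k choose j) * (pochhammer (u + real j) (k - j) * pochhammer (v + real j) (k - j))
            * (pochhammer w j * pochhammer (real k + u + v - w - 1) j))
       = pochhammer (u - w) k * pochhammer (v - w) k"
    (is "sum ?f _ = _")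
proof -
  \<comment> \<open>For this \<open>x\<close> the reflection of \<open>(u - 2x)_{k-j}\<close> is
    \<open>(v+j)_{k-j}\<close> for every \<open>j\<close>.\<close>
  define x where "x = (u + v + real k - 1) / 2"
  have "pochhammer ((u - x) + (w - x)) k = (-1) ^ k * pochhammer (v - w) k"
    by (rule pochhammer_reflect) (simp add: x_def field_simps)
  then have "(-1) ^ k * pochhammer (v - w) k * pochhammer (u - w) k
      = pochhammer ((u - x) + (w - x)) k * pochhammer ((u - x) - (w - x)) k"
    by simp
  also have "\<dots> = (\<Sum>j\<le>k. real (k choose j) *
            (pochhammer ((u - x) + x + real j) (k - j) * pochhammer ((u - x) - x) (k - j)) *
            (pochhammer (x + (w - x)) j * pochhammer (x - (w - x)) j))"
    by (rule pochhammer_pair_convolution[symmetric])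
  also have "\<dots> = (\<Sum>j\<le>k. (-1) ^ k * ?f j)"
  proof (intro sum.cong refl)
    fix j assume "j \<in> {..k}"
    then have j: "j \<le> k" by simp
    have "(-1) ^ (k - j) = (-1 :: real) ^ k * (-1) ^ j"
      using j by (auto simp: minus_one_power_iff)
    then have 1: "pochhammer ((u - x) - x) (k - j) = (-1) ^ k * (-1) ^ j * pochhammer (v + real j) (k - j)"
      using pochhammer_reflect[of "(u - x) - x" "v + real j" "k - j"] j
      by (simp add: x_def field_simps of_nat_diff)
    have 2: "x - (w - x) = real k + u + v - w - 1"
      by (simp add: x_def field_simps)
    show "real (k choose j) *
            (pochhammer ((u - x) + x + real j) (k - j) * pochhammer ((u - x) - x) (k - j)) *
            (pochhammer (x + (w - x)) j * pochhammer (x - (w - x)) j) = (-1) ^ k * ?f j"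
      unfolding 1 2 by simp
  qed
  also have "\<dots> = (-1) ^ k * sum ?f {..k}"
    by (simp add: sum_distrib_left)
  finally show ?thesis
    by (simp add: mult.commute)
qed

section \<open>Connection coefficients and their products\<close>

(* Coefficients of wilson_basis a j in the basis (wilson_basis x l) for l = 0, ..., j. *)
definition basis_conn :: "real \<Rightarrow> real \<Rightarrow> nat \<Rightarrow> nat \<Rightarrow> real" where
  "basis_conn a x j l =
    (if l \<le> j then (-1) ^ (j - l) / fact (j - l)
        * (pochhammer (a + x + real l) (j - l) * pochhammer (a - x) (j - l)) else 0)"

text \<open>The coefficients of \<open>wilson_poly a b c d k\<close> in its defining basis, the
  matrix M(a). Extending by 0 makes it lower unitriangular, so that its rows may be summed over any
  range \<open>j < N\<close> with \<open>k < N\<close>.\<close>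

definition wilson_coeff :: "real \<Rightarrow> real \<Rightarrow> real \<Rightarrow> real \<Rightarrow> nat \<Rightarrow> nat \<Rightarrow> real" where
  "wilson_coeff a b c d k j =
    (if j \<le> k then pochhammer (a + b + real j) (k - j) * pochhammer (a + c + real j) (k - j)
          * pochhammer (a + d + real j) (k - j)
        / (fact (k - j) * pochhammer (real k + a + b + c + d - 1 + real j) (k - j)) else 0)"

lemma basis_conn_upper: "j < l \<Longrightarrow> basis_conn a x j l = 0"
  and basis_conn_diag: "basis_conn a x j j = 1"
  by (simp_all add: basis_conn_def)

lemma wilson_coeff_upper: "k < j \<Longrightarrow> wilson_coeff a b c d k j = 0"
  and wilson_coeff_diag: "wilson_coeff a b c d k k = 1"
  by (simp_all add: wilson_coeff_def)

text \<open>The sum \<open>a + x\<close> absorbs an index shift by \<open>l\<close> as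
  \<open>l/2\<close> in each parameter, while \<open>a - x\<close> is unaffected. This and its
  analogue for \<open>wilson_coeff\<close> reduce identities between matrix entries to column
  0.\<close>

lemma basis_conn_shift:
  "basis_conn a x (l + j) (l + i) = basis_conn (a + real l / 2) (x + real l / 2) j i"
  by (simp add: basis_conn_def algebra_simps)

lemma wilson_coeff_shift:
  "wilson_coeff a b c d (l + k) (l + j)
    = wilson_coeff (a + real l / 2) (b + real l / 2) (c + real l / 2) (d + real l / 2) k j"
  by (simp add: wilson_coeff_def algebra_simps)

lemma wilson_well_defined_shift:
  assumes "wilson_well_defined a b c d (l + k)"
  shows "wilson_well_defined (a + real l / 2) (b + real l / 2) (c + real l / 2) (d + real l / 2) k"
  unfolding wilson_well_defined_def
proof (intro allI impI)
  fix j assume "j \<le> k"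
  then have "pochhammer (real (l + k) + a + b + c + d - 1 + real (l + j)) (l + k - (l + j)) \<noteq> 0"
    using assms by (auto simp only: wilson_well_defined_def add_le_cancel_left)
  then show "pochhammer (real k + (a + real l / 2) + (b + real l / 2) + (c + real l / 2)
      + (d + real l / 2) - 1 + real j) (k - j) \<noteq> 0"
    by (simp add: algebra_simps)
qed

lemma sum_shift_support:
  fixes f :: "nat \<Rightarrow> 'a::comm_monoid_add"
  assumes "l + k < N" "\<And>i. i < l \<Longrightarrow> f i = 0" "\<And>i. l + k < i \<Longrightarrow> f i = 0"
  shows "(\<Sum>i<N. f i) = (\<Sum>i\<le>k. f (l + i))"
proof -
  have "(\<Sum>i<N. f i) = (\<Sum>i\<in>{l..l + k}. f i)"
    using assms by (intro sum.mono_neutral_right) (auto simp: not_le)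
  also have "\<dots> = (\<Sum>i\<le>k. f (l + i))"
    by (rule sum.reindex_bij_witness[of _ "\<lambda>i. l + i" "\<lambda>i. i - l"]) auto
  finally show ?thesis .
qed

text \<open>Composition of two changes of basis. Column 0 is
  \<open>pochhammer_pair_convolution\<close> times \<open>(-1)^k / k!\<close>; the other columns
  follow by the index shift.\<close>

lemma basis_conn_trans:
  assumes "j < N"
  shows "(\<Sum>i<N. basis_conn a x j i * basis_conn x y i l) = basis_conn a y j l"
proof (cases "l \<le> j")
  case True
  then obtain k where j: "j = l + k"
    using le_Suc_ex by blast
  have base: "(\<Sum>i\<le>k. basis_conn a x k i * basis_conn x y i 0) = basis_conn a y k 0" for a x y
  proof -
    have "(\<Sum>i\<le>k. basis_conn a x k i * basis_conn x y i 0)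
        = (\<Sum>i\<le>k. (-1) ^ k / fact k * (real (k choose i) *
            (pochhammer (a + x + real i) (k - i) * pochhammer (a - x) (k - i)) *
            (pochhammer (x + y) i * pochhammer (x - y) i)))"
    proof (intro sum.cong refl)
      fix i assume "i \<in> {..k}"
      then have i: "i \<le> k" by simp
      then have "(-1 :: real) ^ k = (-1) ^ (k - i) * (-1) ^ i"
        by (simp flip: power_add)
      then show "basis_conn a x k i * basis_conn x y i 0 = (-1) ^ k / fact k * (real (k choose i) *
            (pochhammer (a + x + real i) (k - i) * pochhammer (a - x) (k - i)) *
            (pochhammer (x + y) i * pochhammer (x - y) i))"
        using i by (simp add: basis_conn_def binomial_fact mult_ac)
    qed
    also have "\<dots> = (-1) ^ k / fact k * (pochhammer (a + y) k * pochhammer (a - y) k)"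
      unfolding sum_distrib_left[symmetric] pochhammer_pair_convolution ..
    finally show ?thesis
      by (simp add: basis_conn_def)
  qed
  have "(\<Sum>i<N. basis_conn a x j i * basis_conn x y i l)
      = (\<Sum>i\<le>k. basis_conn a x j (l + i) * basis_conn x y (l + i) l)"
    using assms by (intro sum_shift_support) (auto simp: j basis_conn_upper)
  also have "\<dots> = basis_conn a y j l"
    using base basis_conn_shift[of _ _ l _ 0] by (simp add: j basis_conn_shift)
  finally show ?thesis .
next
  case False
  then have zero: "basis_conn a x j i * basis_conn x y i l = 0" for i
    by (cases "i \<le> j") (auto simp: basis_conn_upper)
  show ?thesis
    unfolding zero using False by (simp add: basis_conn_upper)
qed

text \<open>The symmetry of the Wilson polynomials in \<open>a\<close> and \<open>d\<close>, read
  off from coefficients: M(a) B(a,d) = M(d). Column 0 is the Saalschuetz sum with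
  \<open>u = a + b\<close>, \<open>v = a + c\<close>, \<open>w = a - d\<close>.\<close>

lemma wilson_coeff_rebase:
  assumes "k < N" "wilson_well_defined a b c d k"
  shows "(\<Sum>j<N. wilson_coeff a b c d k j * basis_conn a d j l) = wilson_coeff d b a c k l"
proof (cases "l \<le> k")
  case True
  then obtain r where k: "k = l + r"
    using le_Suc_ex by blast
  have base: "(\<Sum>j\<le>r. wilson_coeff a b c d r j * basis_conn a d j 0) = wilson_coeff d b a c r 0"
    if wd: "wilson_well_defined a b c d r" for a b c d
  proof -
    define s where "s = real r + a + b + c + d - 1"
    have s: "pochhammer s r \<noteq> 0"
      using wd by (auto simp: wilson_well_defined_def s_def)
    have "wilson_coeff a b c d r j * basis_conn a d j 0 = pochhammer (a + d) r / (fact r * pochhammer s r) *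
        ((-1) ^ j * real (r choose j) * (pochhammer (a + b + real j) (r - j) * pochhammer (a + c + real j) (r - j))
            * (pochhammer (a - d) j * pochhammer (real r + (a + b) + (a + c) - (a - d) - 1) j))"
      if j: "j \<le> r" for j
    proof -
      \<comment> \<open>Splitting \<open>(s)_r\<close> brings \<open>(s)_j\<close> into the
        numerator as the last Saalschuetz factor, and \<open>(a+d)_j\<close> from
        \<open>basis_conn\<close> completes \<open>(a+d+j)_{r-j}\<close> to a constant.\<close>
      have 1: "pochhammer s r = pochhammer s j * pochhammer (s + real j) (r - j)"
        and 2: "pochhammer (a + d) r = pochhammer (a + d) j * pochhammer (a + d + real j) (r - j)"
        using j by (simp_all add: pochhammer_product)
      have 3: "real r + (a + b) + (a + c) - (a - d) - 1 = s"
        by (simp add: s_def)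
      have "real r + a + b + c + d - 1 + real j = s + real j"
        by (simp add: s_def)
      then have 4: "wilson_coeff a b c d r j = pochhammer (a + b + real j) (r - j)
          * pochhammer (a + c + real j) (r - j) * pochhammer (a + d + real j) (r - j)
          / (fact (r - j) * pochhammer (s + real j) (r - j))"
        using j by (simp add: wilson_coeff_def)
      show ?thesis
        using j s unfolding 3 2 1 4 by (simp add: basis_conn_def binomial_fact field_simps)
    qed
    then have "(\<Sum>j\<le>r. wilson_coeff a b c d r j * basis_conn a d j 0)
        = pochhammer (a + d) r / (fact r * pochhammer s r) *
          (pochhammer (a + b - (a - d)) r * pochhammer (a + c - (a - d)) r)"
      unfolding saalschuetz[symmetric] sum_distrib_left by (intro sum.cong) auto
    then show ?thesis
      by (simp add: wilson_coeff_def s_def algebra_simps)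
  qed
  have "(\<Sum>j<N. wilson_coeff a b c d k j * basis_conn a d j l)
      = (\<Sum>j\<le>r. wilson_coeff a b c d k (l + j) * basis_conn a d (l + j) l)"
    using assms by (intro sum_shift_support) (auto simp: k basis_conn_upper wilson_coeff_upper)
  also have "\<dots> = wilson_coeff d b a c k l"
    using base[OF wilson_well_defined_shift[of a b c d l r]] assms(2)
      basis_conn_shift[of _ _ l _ 0] wilson_coeff_shift[of d b a c l r 0]
    by (simp add: k wilson_coeff_shift)
  finally show ?thesis .
next
  case False
  then have zero: "wilson_coeff a b c d k i * basis_conn a d i l = 0" for i
    by (cases "i \<le> k") (auto simp: basis_conn_upper wilson_coeff_upper)
  show ?thesis
    unfolding zero using False by (simp add: wilson_coeff_upper)
qed

section \<open>Reflection in the antidiagonal\<close>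

text \<open>The two shifts by \<open>N/2\<close> cancel the \<open>N\<close> of the reflected index,
  so \<open>pochhammer_reflect\<close> restores the sum \<open>x + a\<close>, while the difference
  of the dual parameters is \<open>x - a\<close>. By \<open>basis_conn_trans\<close>, B(x,a) inverts
  B(a,x), so the reflection is an inverse up to signs.\<close>

lemma basis_conn_dual:
  assumes "j < N" "l < N"
  shows "basis_conn (1 - a - real N / 2) (1 - x - real N / 2) (N - 1 - l) (N - 1 - j)
       = (-1) ^ (j + l) * basis_conn x a j l"
proof (cases "l \<le> j")
  case True
  have "N - 1 - l - (N - 1 - j) = j - l" "N - 1 - j \<le> N - 1 - l"
    using assms True by auto
  moreover have "pochhammer (1 - a - real N / 2 + (1 - x - real N / 2) + real (N - 1 - j)) (j - l)
      = (-1) ^ (j - l) * pochhammer (x + a + real l) (j - l)"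
    by (rule pochhammer_reflect) (use assms True in \<open>simp add: of_nat_diff field_simps\<close>)
  moreover have "(-1) ^ (j + l) = (-1 :: real) ^ (j - l)"
    using True by (auto simp: minus_one_power_iff)
  ultimately show ?thesis
    using True by (simp add: basis_conn_def)
next
  case False
  then show ?thesis
    using assms by (simp add: basis_conn_def)
qed

text \<open>Reflected, the dual numerators complete \<open>(a+b+l)_{k-l}\<close> to
  \<open>(a+b+j)_{k-j}\<close>, free of \<open>l\<close>, and likewise for \<open>c\<close> and
  \<open>d\<close>. Over a common denominator there remains a difference of order
  \<open>k - j\<close> of a polynomial of degree \<open>k - j - 1\<close>, which vanishes.\<close>

lemma wilson_coeff_dual_orthogonal:
  fixes a b c d :: real
  assumes "j < k" "k < N"
    and wd: "wilson_well_defined a b c d k"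
    and wd': "wilson_well_defined (1 - a - real N / 2) (1 - b - real N / 2)
                (1 - c - real N / 2) (1 - d - real N / 2) (N - 1 - j)"
  shows "(\<Sum>l<N. wilson_coeff a b c d k l * ((-1) ^ (l + j) *
           wilson_coeff (1 - a - real N / 2) (1 - b - real N / 2)
             (1 - c - real N / 2) (1 - d - real N / 2) (N - 1 - j) (N - 1 - l))) = 0"
proof -
  obtain r where k: "k = j + Suc r"
    using \<open>j < k\<close> less_imp_Suc_add by force
  let ?K = "Suc r"
  \<comment> \<open>With \<open>k = j + r + 1\<close> and \<open>l = j + i\<close>, the denominators
    contain \<open>(s+r+i)_{r+1-i}\<close> and, after reflection,
    \<open>(-1)^i (s)_i\<close>.\<close>
  define s where "s = a + b + c + d + 2 * real j"
  let ?t = "\<lambda>l. wilson_coeff a b c d k l * ((-1) ^ (l + j) *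
           wilson_coeff (1 - a - real N / 2) (1 - b - real N / 2)
             (1 - c - real N / 2) (1 - d - real N / 2) (N - 1 - j) (N - 1 - l))"
  define T where "T = pochhammer (a + b + real j) ?K * pochhammer (a + c + real j) ?K
      * pochhammer (a + d + real j) ?K"
  have reflect: "pochhammer (1 - u - real N / 2 + (1 - v - real N / 2) + real (N - 1 - (j + i))) i
      = (-1) ^ i * pochhammer (u + v + real j) i" if "j + i < N" for u v i
    by (rule pochhammer_reflect) (use that in \<open>simp add: of_nat_diff field_simps\<close>)
  have reflect_s: "pochhammer (real (N - 1 - j) + (1 - a - real N / 2) + (1 - b - real N / 2)
          + (1 - c - real N / 2) + (1 - d - real N / 2) - 1 + real (N - 1 - (j + i))) i
      = (-1) ^ i * pochhammer s i" if "j + i < N" for i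
    by (rule pochhammer_reflect) (use that in \<open>simp add: s_def of_nat_diff field_simps\<close>)
  have s1: "pochhammer (s + real r) ?K \<noteq> 0"
  proof -
    have "pochhammer (real k + a + b + c + d - 1 + real j) (k - j) \<noteq> 0"
      using wd \<open>j < k\<close> by (simp add: wilson_well_defined_def)
    then show ?thesis
      by (simp add: k s_def algebra_simps)
  qed
  have s2: "pochhammer s ?K \<noteq> 0"
  proof -
    have "N - 1 - j - (N - 1 - k) = ?K" "N - 1 - k \<le> N - 1 - j"
      using \<open>k < N\<close> by (auto simp: k)
    then show ?thesis
      using wd' reflect_s[of ?K] \<open>k < N\<close> unfolding wilson_well_defined_def
      by (metis k mult_zero_right)
  qed
  \<comment> \<open>The common denominator: it splits into \<open>(s)_i\<close>,
    \<open>(s+r+i)_{r+1-i}\<close> and the factor \<open>(s+i)_r\<close> left in the numerator. It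
    is nonzero because \<open>s1\<close> and \<open>s2\<close>, which come from the well-definedness
    on the two sides, cover all its factors.\<close>
  define Z where "Z = pochhammer s (?K + r)"
  have "pochhammer (s + real r) ?K = (s + real r) * pochhammer (s + real ?K) r"
    by (simp add: pochhammer_rec add_ac)
  then have Z: "Z \<noteq> 0"
    using s1 s2 unfolding Z_def pochhammer_product' by simp
  have Z_split: "Z = pochhammer s i * pochhammer (s + real i) r * pochhammer (s + real r + real i) (?K - i)"
    if "i \<le> ?K" for i
  proof -
    have "?K + r = i + (r + (?K - i))"
      using that by simp
    then show ?thesis
      unfolding Z_def by (simp only: pochhammer_product') (simp add: add_ac)
  qed
  have summand: "?t (j + i) = T / (fact ?K * Z) * ((-1) ^ i * real (?K choose i) * pochhammer (s + real i) r)"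
    if i: "i \<le> ?K" for i
  proof -
    have split: "pochhammer (a + u + real j) ?K
        = pochhammer (a + u + real j) i * pochhammer (a + u + real (j + i)) (?K - i)" for u
      using pochhammer_product[OF i, of "a + u + real j"] by (simp add: add_ac)
    have N: "j + i < N" "N - 1 - j - (N - 1 - (j + i)) = i" "N - 1 - (j + i) \<le> N - 1 - j"
      using i \<open>k < N\<close> by (auto simp: k)
    have 1: "wilson_coeff a b c d k (j + i)
        = pochhammer (a + b + real (j + i)) (?K - i) * pochhammer (a + c + real (j + i)) (?K - i)
          * pochhammer (a + d + real (j + i)) (?K - i)
          / (fact (?K - i) * pochhammer (s + real r + real i) (?K - i))"
    proof -
      have e: "real k + a + b + c + d - 1 + real (j + i) = s + real r + real i" "k - (j + i) = ?K - i"
        by (simp_all add: k s_def)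
      show ?thesis
        unfolding wilson_coeff_def e using i by (simp add: k)
    qed
    have 2: "wilson_coeff (1 - a - real N / 2) (1 - b - real N / 2)
             (1 - c - real N / 2) (1 - d - real N / 2) (N - 1 - j) (N - 1 - (j + i))
        = ((-1) ^ i * pochhammer (a + b + real j) i) * ((-1) ^ i * pochhammer (a + c + real j) i)
          * ((-1) ^ i * pochhammer (a + d + real j) i) / (fact i * ((-1) ^ i * pochhammer s i))"
      unfolding wilson_coeff_def N(2) reflect[OF N(1)] reflect_s[OF N(1)] using N(3) by simp
    have sign: "(-1) ^ (j + i + j) = (-1 :: real) ^ i"
      by (simp add: minus_one_power_iff)
    have nz: "pochhammer s i \<noteq> 0" "pochhammer (s + real i) r \<noteq> 0"
        "pochhammer (s + real r + real i) (?K - i) \<noteq> 0"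
      using Z Z_split[OF i] by auto
    show ?thesis
      unfolding 1 2 sign T_def split Z_split[OF i] binomial_fact[OF i]
      using nz by (simp del: fact_Suc add: field_simps)
  qed
  have "(\<Sum>l<N. ?t l) = (\<Sum>i\<le>?K. ?t (j + i))"
    using assms(1,2) by (intro sum_shift_support) (auto simp: wilson_coeff_upper k)
  also have "\<dots> = T / (fact ?K * Z) * (\<Sum>i\<le>?K. (-1) ^ i * real (?K choose i) * pochhammer (s + real i) r)"
    unfolding sum_distrib_left by (intro sum.cong refl summand) simp
  also have "\<dots> = 0"
    by (subst alternating_sum_pochhammer) simp_all
  finally show ?thesis .
qed

text \<open>Transposition, conjugation by the exchange matrix and conjugation by a diagonal matrix
  of alternating signs all preserve the determinant. The signed exchange matrix \<open>F\<close>
  performs both conjugations at once, up to the sign in \<open>F * F = (-1)^(m-1)\<close>.\<close>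

lemma det_antitranspose:
  fixes r :: "nat \<Rightarrow> nat \<Rightarrow> 'a::comm_ring_1"
  shows "det (mat m m (\<lambda>(i, j). (-1) ^ (i + j) * r (m - 1 - j) (m - 1 - i)))
       = det (mat m m (\<lambda>(i, j). r i j))"
proof -
  define F :: "'a mat" where "F = mat m m (\<lambda>(i, j). if j = m - 1 - i then (-1) ^ i else 0)"
  define R where "R = mat m m (\<lambda>(i, j). r i j)"
  have carrier [simp]: "F \<in> carrier_mat m m" "R \<in> carrier_mat m m"
    by (simp_all add: F_def R_def)
  have dim [simp]: "dim_row F = m" "dim_col F = m" "dim_row R = m" "dim_col R = m"
    by (simp_all add: F_def R_def)
  have F_left: "(F * A) $$ (i, j) = (-1) ^ i * A $$ (m - 1 - i, j)"
    if "A \<in> carrier_mat m m" "i < m" "j < m" for A i j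
  proof -
    have "(F * A) $$ (i, j) = (\<Sum>l<m. if l = m - 1 - i then (-1) ^ i * A $$ (l, j) else 0)"
    proof -
      have "(F * A) $$ (i, j) = (\<Sum>l\<in>{0..<m}. F $$ (i, l) * A $$ (l, j))"
        using that carrier_matD[OF that(1)] by (simp add: scalar_prod_def)
      also have "\<dots> = (\<Sum>l\<in>{0..<m}. if l = m - 1 - i then (-1) ^ i * A $$ (l, j) else 0)"
        using that by (intro sum.cong) (auto simp: F_def)
      finally show ?thesis
        by (simp only: lessThan_atLeast0)
    qed
    then show ?thesis
      using that by simp
  qed
  have F_right: "(A * F) $$ (i, j) = (-1) ^ (m - 1 - j) * A $$ (i, m - 1 - j)"
    if "A \<in> carrier_mat m m" "i < m" "j < m" for A i j
  proof -
    have "(A * F) $$ (i, j) = (\<Sum>l<m. if l = m - 1 - j then (-1) ^ l * A $$ (i, l) else 0)"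
    proof -
      have "(A * F) $$ (i, j) = (\<Sum>l\<in>{0..<m}. A $$ (i, l) * F $$ (l, j))"
        using that carrier_matD[OF that(1)] by (simp add: scalar_prod_def)
      also have "\<dots> = (\<Sum>l\<in>{0..<m}. if l = m - 1 - j then (-1) ^ l * A $$ (i, l) else 0)"
        using that by (intro sum.cong) (auto simp: F_def)
      finally show ?thesis
        by (simp only: lessThan_atLeast0)
    qed
    then show ?thesis
      using that by simp
  qed
  have sign: "(-1) ^ i * (-1) ^ (m - Suc i) = (-1 :: 'a) ^ (m - Suc 0)" if "i < m" for i
    using that by (simp flip: power_add)
  have "F * F = (-1) ^ (m - 1) \<cdot>\<^sub>m 1\<^sub>m m"
    by (rule eq_matI) (auto simp: F_left simp del: index_mult_mat(1), auto simp: F_def sign)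
  then have "det F * det F = ((-1) ^ (m - 1)) ^ m"
    by (simp flip: det_mult[of _ m])
  \<comment> \<open>The exponent \<open>(m - 1) * m\<close> is even.\<close>
  also have "\<dots> = 1"
    by (cases m) (auto simp: minus_one_power_iff)
  finally have det_F: "det F * det F = 1" .
  have prod_carrier: "transpose_mat R * F \<in> carrier_mat m m"
    by (rule mult_carrier_mat) auto
  have "mat m m (\<lambda>(i, j). (-1) ^ (i + j) * r (m - 1 - j) (m - 1 - i))
      = (-1) ^ (m - 1) \<cdot>\<^sub>m (F * (transpose_mat R * F))" (is "?A = ?B")
  proof (rule eq_matI)
    fix i j assume "i < dim_row ?B" "j < dim_col ?B"
    then have ij: "i < m" "j < m"
      by (simp_all add: F_def)
    have "(-1) ^ (m - 1) * ((-1) ^ i * (-1) ^ (m - 1 - j)) = (-1 :: 'a) ^ (i + j)"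
      using ij sign[of j] by (auto simp: minus_one_power_iff)
    moreover have "(F * (transpose_mat R * F)) $$ (i, j)
        = (-1) ^ i * (-1) ^ (m - 1 - j) * r (m - 1 - j) (m - 1 - i)"
      unfolding F_left[OF prod_carrier ij] using ij
      by (simp add: F_right mult.assoc del: index_mult_mat(1)) (simp add: R_def)
    ultimately show "?A $$ (i, j) = ?B $$ (i, j)"
      using ij carrier by (simp add: mult.assoc[symmetric] del: index_mult_mat(1) assoc_mult_mat)
  qed (simp_all add: F_def)
  moreover have "det (F * (transpose_mat R * F)) = det F * (det R * det F)"
    using det_mult[OF carrier(1) prod_carrier] by (simp add: det_mult[of _ m] det_transpose[of _ m])
  ultimately have "det ?A = ((-1) ^ (m - 1)) ^ m * (det F * (det R * det F))"
    by simp
  also have "\<dots> = ((-1) ^ (m - 1)) ^ m * det R"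
    using det_F by (metis mult.commute mult.left_commute mult.right_neutral)
  also have "((-1) ^ (m - 1)) ^ m = (1 :: 'a)"
    by (cases m) (auto simp: minus_one_power_iff)
  finally show ?thesis
    by (simp add: R_def)
qed

section \<open>Determinants of values as minors of the connection matrix\<close>

(* Coefficients of wilson_poly a b c d k in the basis (wilson_basis x l) for l = 0, ..., k. *)
definition wilson_conn :: "real \<Rightarrow> real \<Rightarrow> real \<Rightarrow> real \<Rightarrow> real \<Rightarrow> nat \<Rightarrow> nat \<Rightarrow> real" where
  "wilson_conn a b c d x k l = (\<Sum>j\<le>k. wilson_coeff a b c d k j * basis_conn a x j l)"

lemma wilson_conn_lessThan:
  assumes "k < N"
  shows "wilson_conn a b c d x k l = (\<Sum>j<N. wilson_coeff a b c d k j * basis_conn a x j l)"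
  unfolding wilson_conn_def
  using assms by (intro sum.mono_neutral_left) (auto simp: wilson_coeff_upper)

lemma wilson_conn_upper: "k < l \<Longrightarrow> wilson_conn a b c d x k l = 0"
  by (auto simp: wilson_conn_def basis_conn_upper)

lemma wilson_conn_diag: "wilson_conn a b c d x k k = 1"
proof -
  have "wilson_conn a b c d x k k = (\<Sum>j\<le>k. if j = k then 1 else 0)"
    unfolding wilson_conn_def
    by (intro sum.cong) (auto simp: basis_conn_upper basis_conn_diag wilson_coeff_diag)
  then show ?thesis by simp
qed

lemma wilson_conn_trans:
  assumes "k < N"
  shows "(\<Sum>l<N. wilson_conn a b c d x k l * basis_conn x y l i) = wilson_conn a b c d y k i"
proof -
  have "(\<Sum>l<N. wilson_conn a b c d x k l * basis_conn x y l i)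
      = (\<Sum>l<N. \<Sum>j<N. wilson_coeff a b c d k j * (basis_conn a x j l * basis_conn x y l i))"
    using assms by (simp add: wilson_conn_lessThan sum_distrib_right mult.assoc)
  also have "\<dots> = (\<Sum>j<N. wilson_coeff a b c d k j * (\<Sum>l<N. basis_conn a x j l * basis_conn x y l i))"
    by (subst sum.swap) (simp add: sum_distrib_left)
  also have "\<dots> = wilson_conn a b c d y k i"
    using assms by (auto simp: wilson_conn_lessThan basis_conn_trans intro!: sum.cong)
  finally show ?thesis .
qed

text \<open>In the basis with parameter \<open>s\<close>, all elements but the constant one contain
  the factor vanishing at \<open>-s^2\<close>. Evaluation at this node therefore reads off column
  0.\<close>

lemma poly_wilson_basis: "poly (wilson_basis a j) (- (s\<^sup>2)) = basis_conn a s j 0"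
proof -
  have "(\<Prod>i<j. poly [:(a + real i)\<^sup>2, 1:] (- (s\<^sup>2))) = (\<Prod>i<j. (a + s + real i) * (a - s + real i))"
    by (intro prod.cong) (auto simp: power2_eq_square algebra_simps)
  then show ?thesis
    by (simp add: wilson_basis_def poly_prod basis_conn_def pochhammer_prod prod.distrib lessThan_atLeast0)
qed

lemma poly_wilson_poly: "poly (wilson_poly a b c d k) (- (s\<^sup>2)) = wilson_conn a b c d s k 0"
  by (simp add: wilson_poly_def wilson_conn_def poly_sum poly_wilson_basis wilson_coeff_def)

lemma poly_wilson_denom:
  "poly (wilson_denom n X) t = (\<Prod>l<n. pochhammer (2 * poly X t + real l) l)"
proof -
  have "poly (wilson_denom n X) t = (\<Prod>l\<in>{1..<n}. pochhammer (2 * poly X t + real l) l)"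
    by (simp add: wilson_denom_def poly_prod pochhammer_prod)
  \<comment> \<open>The factor for \<open>l = 0\<close> is 1; with it the product matches the
    diagonal of an \<open>n\<close> by \<open>n\<close> matrix.\<close>
  also have "\<dots> = (\<Prod>l<n. pochhammer (2 * poly X t + real l) l)"
    by (intro prod.mono_neutral_left) (auto simp: not_le)
  finally show ?thesis .
qed

text \<open>The difference of the parameters is \<open>-i\<close>, and \<open>(-i)_l = 0\<close> for
  \<open>l > i\<close>: the basis with parameter \<open>x\<close> is triangular at the nodes
  \<open>-(x+i)^2\<close>.\<close>

lemma basis_conn_node_upper: "i < l \<Longrightarrow> basis_conn x (x + real i) l 0 = 0"
  by (simp add: basis_conn_def pochhammer_of_nat_eq_0_lemma)

lemma basis_conn_node_diag: "basis_conn x (x + real i) i 0 = pochhammer (2 * x + real i) i"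
  by (simp add: basis_conn_def pochhammer_same algebra_simps flip: power_mult_distrib)

text \<open>The matrix of values factors as \<open>T * transpose_mat C\<close>, where
  \<open>T\<close> is lower triangular and the product of its diagonal is the denominator. In this
  product form the equation also holds at the zeros of the denominator.\<close>

lemma poly_wilson_det:
  "poly (wilson_det a b c d n m X) t
    = det (mat n n (\<lambda>(i, j). wilson_conn a b c d (poly X t) (m + i) j)) * poly (wilson_denom n X) t"
proof -
  interpret eval: comm_ring_hom "\<lambda>p. poly p t"
    by unfold_locales auto
  define x where "x = poly X t"
  define C where "C = mat n n (\<lambda>(i, j). wilson_conn a b c d x (m + i) j)"
  define T where "T = mat n n (\<lambda>(i, l). basis_conn x (x + real i) l 0)"
  have carrier [simp]: "C \<in> carrier_mat n n" "T \<in> carrier_mat n n"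
    by (simp_all add: C_def T_def)
  have "poly (wilson_det a b c d n m X) t
      = det (mat n n (\<lambda>(i, j). wilson_conn a b c d (x + real i) (m + j) 0))"
    unfolding wilson_det_def eval.hom_det[symmetric]
    by (intro arg_cong[of _ _ det] eq_matI)
      (auto simp: poly_pcompose poly_wilson_poly x_def)
  also have "mat n n (\<lambda>(i, j). wilson_conn a b c d (x + real i) (m + j) 0) = T * transpose_mat C"
  proof (rule eq_matI)
    fix i j assume "i < dim_row (T * transpose_mat C)" "j < dim_col (T * transpose_mat C)"
    then have ij: "i < n" "j < n"
      by (simp_all add: T_def C_def)
    have "wilson_conn a b c d (x + real i) (m + j) 0
        = (\<Sum>l<n + m. wilson_conn a b c d x (m + j) l * basis_conn x (x + real i) l 0)"
      using ij by (simp add: wilson_conn_trans)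
    \<comment> \<open>At a node with \<open>i < n\<close> the basis elements of index at least
      \<open>n\<close> vanish.\<close>
    also have "\<dots> = (\<Sum>l<n. wilson_conn a b c d x (m + j) l * basis_conn x (x + real i) l 0)"
      using ij by (intro sum.mono_neutral_right) (auto simp: basis_conn_node_upper)
    also have "\<dots> = (T * transpose_mat C) $$ (i, j)"
      using ij by (auto simp: T_def C_def scalar_prod_def lessThan_atLeast0 mult.commute intro!: sum.cong)
    finally show "mat n n (\<lambda>(i, j). wilson_conn a b c d (x + real i) (m + j) 0) $$ (i, j)
        = (T * transpose_mat C) $$ (i, j)"
      using ij by simp
  qed (simp_all add: T_def C_def)
  also have "det (T * transpose_mat C) = det T * det C"
    by (simp add: det_mult[of _ n] det_transpose[of _ n])
  also have "det T = prod_list (diag_mat T)"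
    by (rule det_lower_triangular[of n]) (auto simp: T_def basis_conn_node_upper)
  also have "\<dots> = poly (wilson_denom n X) t"
    by (simp add: prod_list_diag_prod poly_wilson_denom)
      (simp add: T_def basis_conn_node_diag x_def lessThan_atLeast0)
  finally show ?thesis
    by (simp add: C_def x_def)
qed

section \<open>Duality of the minors and the identity\<close>

lemma wilson_well_defined_swap: "wilson_well_defined a b c d k \<Longrightarrow> wilson_well_defined d b a c k"
  by (simp add: wilson_well_defined_def add_ac)

text \<open>Here \<open>p\<close> is M(a) B(a,x), and duality factors its partner as
  \<open>q\<close> = B(x,d) \<open>r\<close>, with \<open>r\<close> the signed reflection of the
  dual coefficients. By transitivity and symmetry \<open>p * q\<close> is M(d) \<open>r\<close>,
  whose entries vanish where \<open>complementary_minors\<close> requires it.\<close>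

lemma wilson_conn_dual_minors:
  fixes a b c d x :: real and n m :: nat
  defines "h \<equiv> real (m + n) / 2"
  assumes wd: "\<And>k. m \<le> k \<Longrightarrow> k < m + n \<Longrightarrow> wilson_well_defined a b c d k"
    and wd': "\<And>k. n \<le> k \<Longrightarrow> k < n + m \<Longrightarrow>
           wilson_well_defined (1 - d - h) (1 - b - h) (1 - a - h) (1 - c - h) k"
  shows "det (mat n n (\<lambda>(i, j). wilson_conn a b c d x (m + i) j))
       = det (mat m m (\<lambda>(i, j).
           wilson_conn (1 - d - h) (1 - b - h) (1 - a - h) (1 - c - h) (1 - x - h) (n + i) j))"
proof -
  define N where "N = m + n"
  define p where "p = wilson_conn a b c d x"
  define p' where "p' = wilson_conn (1 - d - h) (1 - b - h) (1 - a - h) (1 - c - h) (1 - x - h)"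
  \<comment> \<open>Column \<open>j\<close> of \<open>q\<close> comes from degree
    \<open>N - 1 - j\<close> on the dual side, which is at least \<open>n\<close> exactly when
    \<open>j < m\<close>.\<close>
  define q where "q l j = (-1) ^ (l + j) * p' (N - 1 - j) (N - 1 - l)" for l j
  define r where "r i j = (-1) ^ (i + j) *
    wilson_coeff (1 - d - h) (1 - b - h) (1 - a - h) (1 - c - h) (N - 1 - j) (N - 1 - i)" for i j
  have h: "h = real N / 2"
    by (simp add: h_def N_def)
  have q_eq: "q l j = (\<Sum>i<N. basis_conn x d l i * r i j)" if "l < N" "j < N" for l j
  proof -
    have "p' (N - 1 - j) (N - 1 - l) =
        (\<Sum>i<N. wilson_coeff (1 - d - h) (1 - b - h) (1 - a - h) (1 - c - h) (N - 1 - j) i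
           * basis_conn (1 - d - h) (1 - x - h) i (N - 1 - l))"
      unfolding p'_def by (rule wilson_conn_lessThan) (use that in simp)
    also have "\<dots> = (\<Sum>i<N. wilson_coeff (1 - d - h) (1 - b - h) (1 - a - h) (1 - c - h) (N - 1 - j) (N - 1 - i)
           * basis_conn (1 - d - h) (1 - x - h) (N - 1 - i) (N - 1 - l))"
      by (subst sum.nat_diff_reindex[symmetric]) simp
    also have "\<dots> = (\<Sum>i<N. (-1) ^ (l + j) * (basis_conn x d l i * r i j))"
    proof (intro sum.cong refl)
      fix i assume "i \<in> {..<N}"
      then have 1: "basis_conn (1 - d - h) (1 - x - h) (N - 1 - i) (N - 1 - l)
          = (-1) ^ (l + i) * basis_conn x d l i"
        unfolding h using that by (intro basis_conn_dual) auto
      have 2: "(-1) ^ (l + i) = (-1) ^ (l + j) * (-1 :: real) ^ (i + j)"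
        by (auto simp: minus_one_power_iff)
      show "wilson_coeff (1 - d - h) (1 - b - h) (1 - a - h) (1 - c - h) (N - 1 - j) (N - 1 - i)
           * basis_conn (1 - d - h) (1 - x - h) (N - 1 - i) (N - 1 - l)
          = (-1) ^ (l + j) * (basis_conn x d l i * r i j)"
        unfolding 1 2 r_def by simp
    qed
    finally have "p' (N - 1 - j) (N - 1 - l) = (-1) ^ (l + j) * (\<Sum>i<N. basis_conn x d l i * r i j)"
      by (simp only: sum_distrib_left)
    then show ?thesis
      unfolding q_def by (simp add: mult.assoc[symmetric] flip: power_add)
  qed
  have "det (mat n n (\<lambda>(i, j). p (m + i) j)) = (-1) ^ (m * n) * det (mat m m (\<lambda>(i, j). q (n + i) j))"
  proof (rule complementary_minors)
    fix k j assume k: "m \<le> k" "k < m + n" and j: "j < m"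
    have "(\<Sum>l<N. p k l * q l j) = (\<Sum>l<N. \<Sum>i<N. p k l * basis_conn x d l i * r i j)"
      using j by (auto simp: q_eq N_def sum_distrib_left mult.assoc intro!: sum.cong)
    also have "\<dots> = (\<Sum>i<N. (\<Sum>l<N. p k l * basis_conn x d l i) * r i j)"
      by (subst sum.swap) (simp add: sum_distrib_right)
    also have "\<dots> = (\<Sum>i<N. wilson_coeff d b a c k i * r i j)"
    proof (intro sum.cong refl arg_cong2[of _ _ _ _ "(*)"])
      fix i
      have "(\<Sum>l<N. p k l * basis_conn x d l i) = wilson_conn a b c d d k i"
        unfolding p_def using k by (intro wilson_conn_trans) (simp add: N_def)
      also have "\<dots> = (\<Sum>l<N. wilson_coeff a b c d k l * basis_conn a d l i)"
        using k by (intro wilson_conn_lessThan) (simp add: N_def)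
      also have "\<dots> = wilson_coeff d b a c k i"
        using k by (intro wilson_coeff_rebase wd) (simp_all add: N_def)
      finally show "(\<Sum>l<N. p k l * basis_conn x d l i) = wilson_coeff d b a c k i" .
    qed
    also have "\<dots> = 0"
      unfolding r_def h
    proof (rule wilson_coeff_dual_orthogonal)
      show "wilson_well_defined d b a c k"
        using k by (rule wilson_well_defined_swap[OF wd])
      show "wilson_well_defined (1 - d - real N / 2) (1 - b - real N / 2) (1 - a - real N / 2)
          (1 - c - real N / 2) (N - 1 - j)"
        unfolding h[symmetric] using j by (intro wd') (auto simp: N_def)
    qed (use k j in \<open>auto simp: N_def\<close>)
    finally show "(\<Sum>l<m + n. p k l * q l j) = 0"
      by (simp add: N_def)
  next
    fix l j assume "l < j" "j < m"
    then show "q l j = 0"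
      by (simp add: q_def p'_def N_def wilson_conn_upper)
  qed (simp_all add: p_def p'_def q_def wilson_conn_diag wilson_conn_upper)
  \<comment> \<open>The lower left minor of \<open>q\<close> is the signed reflection of the minor
    of \<open>p'\<close>, up to a factor \<open>(-1)^n\<close> per row; these factors cancel the
    sign \<open>(-1)^(m * n)\<close>.\<close>
  also have "mat m m (\<lambda>(i, j). q (n + i) j)
      = (-1) ^ n \<cdot>\<^sub>m mat m m (\<lambda>(i, j). (-1) ^ (i + j) * p' (n + (m - 1 - j)) (m - 1 - i))"
    by (rule eq_matI) (auto simp: q_def N_def power_add algebra_simps)
  also have "det \<dots> = ((-1) ^ n) ^ m * det (mat m m (\<lambda>(i, j). p' (n + i) j))"
    using det_antitranspose[of m "\<lambda>i j. p' (n + i) j"] by simp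
  finally have "det (mat n n (\<lambda>(i, j). p (m + i) j))
      = ((-1) ^ (m * n) * ((-1) ^ n) ^ m) * det (mat m m (\<lambda>(i, j). p' (n + i) j))"
    by simp
  also have "(-1) ^ (m * n) * ((-1) ^ n) ^ m = (1 :: real)"
    by (simp add: mult.commute flip: power_mult power_add power_mult_distrib)
  finally show ?thesis
    by (simp add: p_def p'_def)
qed

theorem corollary5p10:
  fixes n m :: nat and a b c d h :: real
  defines "h \<equiv> real n / 2 + real m / 2"
  assumes "\<And>k. m \<le> k \<Longrightarrow> k < m + n \<Longrightarrow> wilson_well_defined (a - h) (b - h) (c - h) (d - h) k"
    and "\<And>k. n \<le> k \<Longrightarrow> k < n + m \<Longrightarrow> wilson_well_defined (1 - d) (1 - b) (1 - a) (1 - c) k"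
  shows "wilson_W (a - h) (b - h) (c - h) (d - h) n m [:a - h, 1:]
       = wilson_W (1 - d) (1 - b) (1 - a) (1 - c) m n [:1 - a, -1:]"
proof -
  let ?L = "wilson_det (a - h) (b - h) (c - h) (d - h) n m [:a - h, 1:]"
  let ?R = "wilson_det (1 - d) (1 - b) (1 - a) (1 - c) m n [:1 - a, -1:]"
  let ?dL = "wilson_denom n [:a - h, 1:]" and ?dR = "wilson_denom m [:1 - a, -1:]"
  have h: "h = real (m + n) / 2"
    by (simp add: h_def field_simps)
  \<comment> \<open>Cross-multiplied, the identity is one of polynomials and can be checked at every
    real \<open>t\<close>.\<close>
  have "poly (?L * ?dR) t = poly (?R * ?dL) t" for t
  proof -
    let ?x = "poly [:a - h, 1:] t"
    \<comment> \<open>The dual of \<open>u - h\<close> for size \<open>n + m\<close> is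
      \<open>1 - u\<close>; likewise the evaluation point \<open>t + a - h\<close> becomes
      \<open>1 - a - t\<close>.\<close>
    have params: "1 - (u - h) - h = 1 - u" for u
      by simp
    have "det (mat n n (\<lambda>(i, j). wilson_conn (a - h) (b - h) (c - h) (d - h) ?x (m + i) j))
        = det (mat m m (\<lambda>(i, j). wilson_conn (1 - d) (1 - b) (1 - a) (1 - c) (1 - ?x - h) (n + i) j))"
      using wilson_conn_dual_minors[of m n "a - h" "b - h" "c - h" "d - h" ?x, folded h, unfolded params]
        assms(2,3) by blast
    moreover have "1 - ?x - h = poly [:1 - a, -1:] t"
      by simp
    ultimately show ?thesis
      by (simp only: poly_mult poly_wilson_det mult_ac)
  qed
  then have "?L * ?dR = ?R * ?dL"
    using poly_eq_poly_eq_iff by blast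
  moreover have "?dL \<noteq> 0" "?dR \<noteq> 0"
    by (rule wilson_denom_nonzero, simp)+
  ultimately show ?thesis
    by (simp add: wilson_W_def eq_fract)
qed

end
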